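(* Let $D$ be $\mathbb{N}$ or $\mathbb{Z}$. Let $\Sigma$ be the one-sorted signature having a constant for each decimal numeral denoting an element of $D$, the binary operation $+$ and, if $D=\mathbb{Z}$, the unary operation $-$, with the usual interpretation in $D$. Let $A$ be the set of all closed equations over $\Sigma$ that are true in $D$. Extend $\Sigma$ with two unary operation symbols $l_s$ and $r_s$ (the sum splitting operators), and let $T$ be the equational theory over the extended signature with axioms $A$ together with the two equations $$l_s(X+Y)=X,\qquad r_s(X+Y)=Y,$$ where $X,Y$ are variables ranging over the sort. Then arithmetic extended in this way is inconsistent: in particular, the equation $1=2$, which is false in $D$, is derivable from $T$ in equational logic.
   Context: An arithmetical quantity (AQ) is an arithmetical expression, and a sumterm is an expression whose leading function symbol is addition. The sum splitting operators $l_s,r_s$ are meant to return the left and right summand of a sumterm, so that $l_s(X+Y)$ is $X$ and $r_s(X+Y)$ is $Y$. Here no distinction is made between expressions and their values, or between syntactic equality of expressions and the ordinary equality $=$ of arithmetic. Hence the defining equations of $l_s$ and $r_s$ are stated with ordinary equality $=$, hold for all $X,Y$, and are subject to the usual rules of equational logic (reflexivity, symmetry, transitivity, substitution for variables, and replacement of equals by equals, including inside arguments of $l_s$ and $r_s$). *)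

theory Defs
  imports Main
begin

type_synonym 'f signature = "('f \<times> nat) set"

datatype 'f tm = Var nat | Fun 'f "'f tm list"

type_synonym 'f equation = "'f tm \<times> 'f tm"

inductive wf_tm :: "'f signature \<Rightarrow> 'f tm \<Rightarrow> bool" for F where
  "wf_tm F (Var x)"
| "(f, length ts) \<in> F \<Longrightarrow> (\<And>t. t \<in> set ts \<Longrightarrow> wf_tm F t) \<Longrightarrow> wf_tm F (Fun f ts)"

primrec vars :: "'f tm \<Rightarrow> nat set" where
  "vars (Var x) = {x}"
| "vars (Fun f ts) = \<Union> (set (map vars ts))"

primrec subst :: "(nat \<Rightarrow> 'f tm) \<Rightarrow> 'f tm \<Rightarrow> 'f tm" where
  "subst \<sigma> (Var x) = \<sigma> x"
| "subst \<sigma> (Fun f ts) = Fun f (map (subst \<sigma>) ts)"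

primrec eval :: "('f \<Rightarrow> 'a list \<Rightarrow> 'a) \<Rightarrow> (nat \<Rightarrow> 'a) \<Rightarrow> 'f tm \<Rightarrow> 'a" where
  "eval I \<alpha> (Var x) = \<alpha> x"
| "eval I \<alpha> (Fun f ts) = I f (map (eval I \<alpha>) ts)"

text \<open>Equational logic over the signature \<open>F\<close> with axioms \<open>E\<close>. Only terms over \<open>F\<close> may be
  introduced, by reflexivity or by substitution.\<close>

inductive derivable :: "'f signature \<Rightarrow> 'f equation set \<Rightarrow> 'f tm \<Rightarrow> 'f tm \<Rightarrow> bool"
  for F E where
  axiom: "(s, t) \<in> E \<Longrightarrow> derivable F E s t"
| refl: "wf_tm F t \<Longrightarrow> derivable F E t t"
| sym: "derivable F E s t \<Longrightarrow> derivable F E t s"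
| trans: "derivable F E s t \<Longrightarrow> derivable F E t u \<Longrightarrow> derivable F E s u"
| subst: "derivable F E s t \<Longrightarrow> (\<And>x. wf_tm F (\<sigma> x)) \<Longrightarrow> derivable F E (subst \<sigma> s) (subst \<sigma> t)"
| cong: "(f, length ss) \<in> F \<Longrightarrow> list_all2 (derivable F E) ss ts \<Longrightarrow>
    derivable F E (Fun f ss) (Fun f ts)"

text \<open>\<open>Numeral k\<close> is the constant symbol given by the decimal numeral of the integer \<open>k\<close>; for
  negative \<open>k\<close> this is a constant distinct from the term that applies \<open>Minus\<close> to a numeral.
  The domain \<open>D\<close> is \<open>\<nat>\<close> or \<open>\<int>\<close>, both taken as sets of integers.\<close>

datatype symb = Numeral int | Plus | Minus | LS | RS

definition arith_sig :: "int set \<Rightarrow> symb signature" where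
  "arith_sig D = {(Numeral k, 0) | k. k \<in> D} \<union> {(Plus, 2)} \<union> (if D = \<int> then {(Minus, 1)} else {})"

text \<open>The values on arguments not covered here, in particular for \<open>LS\<close> and \<open>RS\<close>, are irrelevant:
  only terms over \<open>arith_sig D\<close> are ever interpreted.\<close>

fun arith_interp :: "symb \<Rightarrow> int list \<Rightarrow> int" where
  "arith_interp (Numeral k) [] = k"
| "arith_interp Plus [a, b] = a + b"
| "arith_interp Minus [a] = - a"
| "arith_interp _ _ = undefined"

definition true_in :: "int set \<Rightarrow> symb equation \<Rightarrow> bool" where
  "true_in D e \<longleftrightarrow> (\<forall>\<alpha>. range \<alpha> \<subseteq> D \<longrightarrow> eval arith_interp \<alpha> (fst e) = eval arith_interp \<alpha> (snd e))"

definition closed_arith_eqs :: "int set \<Rightarrow> symb equation set" where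
  "closed_arith_eqs D = {(s, t). wf_tm (arith_sig D) s \<and> wf_tm (arith_sig D) t \<and>
     vars s = {} \<and> vars t = {}}"

definition arith_axioms :: "int set \<Rightarrow> symb equation set" where
  "arith_axioms D = {e \<in> closed_arith_eqs D. true_in D e}"

definition split_sig :: "int set \<Rightarrow> symb signature" where
  "split_sig D = arith_sig D \<union> {(LS, 1), (RS, 1)}"

definition split_axioms :: "int set \<Rightarrow> symb equation set" where
  "split_axioms D = arith_axioms D \<union>
     {(Fun LS [Fun Plus [Var 0, Var 1]], Var 0),
      (Fun RS [Fun Plus [Var 0, Var 1]], Var 1)}"

text \<open>Inconsistency of the extension as a theory of arithmetic: it derives a closed equation
  of arithmetic that is false in \<open>D\<close>.\<close>

definition split_inconsistent :: "int set \<Rightarrow> bool" where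
  "split_inconsistent D \<longleftrightarrow> (\<exists>(s, t) \<in> closed_arith_eqs D.
     \<not> true_in D (s, t) \<and> derivable (split_sig D) (split_axioms D) s t)"

abbreviation num :: "int \<Rightarrow> symb tm" where
  "num k \<equiv> Fun (Numeral k) []"

end

theory Submission
  imports Defs
begin

text \<open>
  The sum splitting operators would have to recover the summands of a sum from its value, but
  a number is a sum in several ways. Already commutativity is fatal: \<open>1 + 2 = 2 + 1\<close> is a true
  closed equation, so replacement under \<open>l\<^sub>s\<close> gives \<open>1 = l\<^sub>s(1 + 2) = l\<^sub>s(2 + 1) = 2\<close>.
\<close>

lemma wf_num: "k \<in> D \<Longrightarrow> wf_tm (arith_sig D) (num k)"
  by (auto intro!: wf_tm.intros simp: arith_sig_def)

lemma wf_plus: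
  "wf_tm (arith_sig D) s \<Longrightarrow> wf_tm (arith_sig D) t \<Longrightarrow> wf_tm (arith_sig D) (Fun Plus [s, t])"
  by (rule wf_tm.intros(2)) (simp add: arith_sig_def, auto)

lemma wf_tm_mono: "wf_tm F t \<Longrightarrow> F \<subseteq> G \<Longrightarrow> wf_tm G t"
  by (induction rule: wf_tm.induct) (auto intro: wf_tm.intros)

lemma num_eq_closed:
  assumes "a \<in> D" "b \<in> D"
  shows "(num a, num b) \<in> closed_arith_eqs D"
  using assms by (simp add: closed_arith_eqs_def wf_num)

text \<open>An assignment into \<open>D\<close> must exist for a false closed equation to be refuted.\<close>

lemma num_eq_true_iff:
  assumes "D \<noteq> {}"
  shows "true_in D (num a, num b) \<longleftrightarrow> a = b"
proof -
  obtain d where "d \<in> D" using assms by blast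
  then have "range (\<lambda>x :: nat. d) \<subseteq> D" by auto
  then show ?thesis unfolding true_in_def by auto
qed

text \<open>The first equation for the splitting operators, instantiated at numerals.\<close>

lemma derivable_LS_plus:
  assumes "a \<in> D" "b \<in> D"
  shows "derivable (split_sig D) (split_axioms D) (Fun LS [Fun Plus [num a, num b]]) (num a)"
proof -
  let ?\<sigma> = "\<lambda>x :: nat. if x = 0 then num a else num b"
  have "wf_tm (split_sig D) (?\<sigma> x)" for x
    using assms by (auto intro!: wf_tm_mono[OF wf_num] simp: split_sig_def)
  moreover have "derivable (split_sig D) (split_axioms D)
      (Fun LS [Fun Plus [Var 0, Var 1]]) (Var 0)"
    by (rule derivable.axiom) (simp add: split_axioms_def)
  ultimately show ?thesis
    using derivable.subst[where \<sigma> = ?\<sigma>] by fastforce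
qed

text \<open>Two representations of one value as a sum force their left summands to be equal.\<close>

lemma derivable_left_summands:
  assumes "a \<in> D" "b \<in> D" "c \<in> D" "d \<in> D" and "a + b = c + d"
  shows "derivable (split_sig D) (split_axioms D) (num a) (num c)"
proof -
  have "(Fun Plus [num a, num b], Fun Plus [num c, num d]) \<in> arith_axioms D"
    using assms
    by (simp add: arith_axioms_def closed_arith_eqs_def true_in_def wf_num wf_plus)
  then have "derivable (split_sig D) (split_axioms D)
      (Fun Plus [num a, num b]) (Fun Plus [num c, num d])"
    by (intro derivable.axiom) (simp add: split_axioms_def)
  then have "derivable (split_sig D) (split_axioms D)
      (Fun LS [Fun Plus [num a, num b]]) (Fun LS [Fun Plus [num c, num d]])"
    by (intro derivable.cong) (simp_all add: split_sig_def)
  then show ?thesis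
    using derivable_LS_plus[OF assms(1,2)] derivable_LS_plus[OF assms(3,4)]
    by (blast intro: derivable.sym derivable.trans)
qed

theorem proposition5p1:
  fixes D :: "int set"
  assumes "D = \<nat> \<or> D = \<int>"
  shows "split_inconsistent D \<and>
    (num 1, num 2) \<in> closed_arith_eqs D \<and>
    \<not> true_in D (num 1, num 2) \<and>
    derivable (split_sig D) (split_axioms D) (num 1) (num 2)"
proof -
  have D: "1 \<in> D" "2 \<in> D" using assms by auto
  have closed: "(num 1, num 2) \<in> closed_arith_eqs D"
    using D by (rule num_eq_closed)
  have "D \<noteq> {}" using D by blast
  then have false: "\<not> true_in D (num 1, num 2)"
    by (simp add: num_eq_true_iff)
  have "derivable (split_sig D) (split_axioms D) (num 1) (num 2)"
    using D(1) D(2) D(2) D(1) by (rule derivable_left_summands) simp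
  with closed false show ?thesis
    unfolding split_inconsistent_def by blast
qed

end
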